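(* Let $k\ge 2$ and let $\mathbf{N}^{\diamondsuit}$ be the augmented hypernetwork of a core hypernetwork $\mathbf{N}$ consisting of $k+1$ nodes of identical type. Assume one-dimensional internal dynamics for each of the nodes, and write $F$ for the response function of the $y$-nodes, so that $$\dot y_0=F\Big(y_0,\bigoplus_{\sigma\in S^0_{k+1}}\mathbf{x}_\sigma\Big),\qquad \dot y_1=F\Big(y_1,\bigoplus_{\sigma\in S^1_{k+1}}\mathbf{x}_\sigma\Big).$$ Then the space $\{y_0=y_1\}$ is invariant for all admissible systems for $\mathbf{N}^{\diamondsuit}$ with $F$ polynomial of total degree strictly less than $\frac{k(k+1)}{2}$, but not for all admissible systems with $F$ polynomial of total degree $\frac{k(k+1)}{2}$. In particular, $\{y_0=y_1\}$ is not a robust synchrony space, i.e., it is not invariant under all $\mathbf{N}^{\diamondsuit}$-admissible vector fields.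
   Context: **Hypernetwork.** A hypernetwork is a tuple $\mathbf{N}=(V,H,s,t)$ with $V$ a finite set of vertices (nodes) and $H$ a finite set of hyperedges. The map $s$ assigns to each hyperedge $h$ a finite ordered list of source vertices $s(h)=(s_1(h),\ldots,s_m(h))\in V^m$ (repetitions allowed; $m$ is the order of $h$). The map $t:H\to V$ assigns to each hyperedge a unique target vertex. All vertices and hyperedges are assigned a type (from some finite set) such that: (1) if $h_1,h_2\in H$ have the same type, then they have equal order, $s_i(h_1)$ and $s_i(h_2)$ have the same type for each $i$, and $t(h_1)$, $t(h_2)$ have the same type; (2) if $v_1,v_2\in V$ have the same type, then there is a type-preserving bijection $t^{-1}(v_1)\to t^{-1}(v_2)$. **Admissible vector fields.** (One-dimensional internal phase spaces.) For $x\in\mathbb{R}^V$ and a hyperedge $h$ write $\mathbf{x}_{s(h)}=(x_{s_1(h)},\ldots,x_{s_m(h)})$. A map $f:\mathbb{R}^V\to\mathbb{R}^V$ is $\mathbf{N}$-admissible if $f_v(x)=F_v\big(\bigoplus_{h:\,t(h)=v}\mathbf{x}_{s(h)}\big)$ for response functions $F_v$ (arguments indexed by the hyperedges targeting $v$) such that for any vertices $v_1,v_2$ of the same type (possibly equal) and any hyperedge-type-preserving bijection $\alpha:t^{-1}(v_1)\to t^{-1}(v_2)$ one has $F_{v_2}\big(\bigoplus_{t(h_2)=v_2}\mathbf{X}_{h_2}\big)=F_{v_1}\big(\bigoplus_{t(h_1)=v_1}\mathbf{X}_{\alpha(h_1)}\big)$ as an identity in the inputs. A subspace $W$ is invariant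 if $f(W)\subset W$ (equivalently, dynamically invariant for $\dot x=f(x)$). **Augmented hypernetwork.** $S_{k+1}$ is the group of permutations of $\{0,\ldots,k\}$; $S^0_{k+1}$ and $S^1_{k+1}$ are its sets of even and odd permutations, and $\mathrm{sgn}(\sigma)=0$ for $\sigma$ even, $\mathrm{sgn}(\sigma)=1$ for $\sigma$ odd. Let $\mathbf{N}$ (the core) be a hypernetwork with $k+1\ge 3$ nodes $v_0,\ldots,v_k$, all of identical type. The augmented hypernetwork $\mathbf{N}^{\diamondsuit}$ is obtained from $\mathbf{N}$ by adding two nodes $w_0,w_1$ of the same type (different from that of the $v_i$), a self-loop (order-one hyperedge from the node to itself) on each of $w_0$ and $w_1$, and $(k+1)!$ hyperedges $h_\sigma$ of order $k$, all of one same new type, labelled by $\sigma\in S_{k+1}$, with $$s(h_\sigma)=(v_{\sigma(1)},\ldots,v_{\sigma(k)}),\qquad t(h_\sigma)=w_{\mathrm{sgn}(\sigma)}.$$ **Equations of motion.** $x_0,\ldots,x_k\in\mathbb{R}$ are the states of $v_0,\ldots,v_k$ and $y_0,y_1\in\mathbb{R}$ those of $w_0,w_1$. Write $\mathbf{x}_\sigma=(x_{\sigma(1)},\ldots,x_{\sigma(k)})\in\mathbb{R}^k$. In an $\mathbf{N}^{\diamondsuit}$-admissible system each $\dot x_i$ depends only on the $x$-variables, through an $\mathbf{N}$-admissible vector field, and the $y$-equations are as displayed in the claim, where $F:\mathbb{R}\oplus\bigoplus_{\sigma\in S^0_{k+1}}\mathbb{R}^k\to\mathbb{R}$ is invariant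 under all permutations of its $\frac{(k+1)!}{2}$ entries in $\mathbb{R}^k$ (so these may be substituted in arbitrary order, and since $\#S^0_{k+1}=\#S^1_{k+1}$ the equation for $\dot y_1$ is well defined). *)

theory Defs
  imports
    Complex_Main
    "HOL-Library.FuncSet"
    "HOL-Combinatorics.Permutations"
    "HOL-Library.Poly_Mapping"
begin

section \<open>Hypernetworks\<close>

record ('v, 'h, 's, 't) hypernet =
  verts  :: "'v set"
  hedges :: "'h set"
  src    :: "'h \<Rightarrow> 'v list"
  tgt    :: "'h \<Rightarrow> 'v"
  vtype  :: "'v \<Rightarrow> 's"
  htype  :: "'h \<Rightarrow> 't"

definition in_edges :: "('v, 'h, 's, 't) hypernet \<Rightarrow> 'v \<Rightarrow> 'h set" where
  "in_edges N v = {h \<in> hedges N. tgt N h = v}"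

definition type_bij ::
    "('v, 'h, 's, 't) hypernet \<Rightarrow> 'v \<Rightarrow> 'v \<Rightarrow> ('h \<Rightarrow> 'h) \<Rightarrow> bool" where
  "type_bij N v1 v2 \<alpha> \<longleftrightarrow>
     bij_betw \<alpha> (in_edges N v1) (in_edges N v2) \<and>
     (\<forall>h \<in> in_edges N v1. htype N (\<alpha> h) = htype N h)"

definition hypernetwork :: "('v, 'h, 's, 't) hypernet \<Rightarrow> bool" where
  "hypernetwork N \<longleftrightarrow>
     finite (verts N) \<and> finite (hedges N) \<and>
     (\<forall>h \<in> hedges N. set (src N h) \<subseteq> verts N \<and> tgt N h \<in> verts N) \<and>
     (\<forall>h1 \<in> hedges N. \<forall>h2 \<in> hedges N. htype N h1 = htype N h2 \<longrightarrow>
        length (src N h1) = length (src N h2) \<and>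
        (\<forall>i < length (src N h1). vtype N (src N h1 ! i) = vtype N (src N h2 ! i)) \<and>
        vtype N (tgt N h1) = vtype N (tgt N h2)) \<and>
     (\<forall>v1 \<in> verts N. \<forall>v2 \<in> verts N. vtype N v1 = vtype N v2 \<longrightarrow>
        (\<exists>\<alpha>. type_bij N v1 v2 \<alpha>))"


section \<open>Admissible vector fields\<close>

text \<open>The phase space is the set of real-valued functions on the vertices, represented as
  extensional functions. Vectors in the m-dimensional real space belonging to a hyperedge of
  order m are real lists of length m.\<close>

definition state_space :: "('v, 'h, 's, 't) hypernet \<Rightarrow> ('v \<Rightarrow> real) set" where
  "state_space N = verts N \<rightarrow>\<^sub>E UNIV"

definition input_space :: "('v, 'h, 's, 't) hypernet \<Rightarrow> 'v \<Rightarrow> ('h \<Rightarrow> real list) set" where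
  "input_space N v = (\<Pi>\<^sub>E h \<in> in_edges N v. {l. length l = length (src N h)})"

definition response_functions ::
    "('v, 'h, 's, 't) hypernet \<Rightarrow> ('v \<Rightarrow> ('h \<Rightarrow> real list) \<Rightarrow> real) \<Rightarrow> bool" where
  "response_functions N F \<longleftrightarrow>
     (\<forall>v1 \<in> verts N. \<forall>v2 \<in> verts N. \<forall>\<alpha>. vtype N v1 = vtype N v2 \<and> type_bij N v1 v2 \<alpha> \<longrightarrow>
        (\<forall>X \<in> input_space N v2. F v2 X = F v1 (\<lambda>h \<in> in_edges N v1. X (\<alpha> h))))"

definition vector_field ::
    "('v, 'h, 's, 't) hypernet \<Rightarrow> ('v \<Rightarrow> ('h \<Rightarrow> real list) \<Rightarrow> real) \<Rightarrow>
     ('v \<Rightarrow> real) \<Rightarrow> ('v \<Rightarrow> real)" where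
  "vector_field N F x = (\<lambda>v \<in> verts N. F v (\<lambda>h \<in> in_edges N v. map x (src N h)))"

definition admissible ::
    "('v, 'h, 's, 't) hypernet \<Rightarrow> (('v \<Rightarrow> real) \<Rightarrow> ('v \<Rightarrow> real)) \<Rightarrow> bool" where
  "admissible N f \<longleftrightarrow>
     (\<exists>F. response_functions N F \<and> (\<forall>x \<in> state_space N. f x = vector_field N F x))"

definition invariant_under :: "(('v \<Rightarrow> real) \<Rightarrow> ('v \<Rightarrow> real)) \<Rightarrow> ('v \<Rightarrow> real) set \<Rightarrow> bool" where
  "invariant_under f W \<longleftrightarrow> f ` W \<subseteq> W"

definition robustly_invariant ::
    "('v, 'h, 's, 't) hypernet \<Rightarrow> ('v \<Rightarrow> real) set \<Rightarrow> bool" where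
  "robustly_invariant N W \<longleftrightarrow> (\<forall>f. admissible N f \<longrightarrow> invariant_under f W)"


section \<open>Polynomial response functions\<close>

text \<open>A real polynomial in variables indexed by \<open>'i\<close> is a finitely supported map from
  monomials (finitely supported exponent functions) to coefficients.\<close>

type_synonym 'i real_mpoly = "('i \<Rightarrow>\<^sub>0 nat) \<Rightarrow>\<^sub>0 real"

definition mpoly_eval :: "'i real_mpoly \<Rightarrow> ('i \<Rightarrow> real) \<Rightarrow> real" where
  "mpoly_eval p x =
     (\<Sum>m \<in> Poly_Mapping.keys p. Poly_Mapping.lookup p m *
        (\<Prod>i \<in> Poly_Mapping.keys m. x i ^ Poly_Mapping.lookup m i))"

definition mpoly_vars :: "'i real_mpoly \<Rightarrow> 'i set" where
  "mpoly_vars p = (\<Union>m \<in> Poly_Mapping.keys p. Poly_Mapping.keys m)"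

text \<open>The zero polynomial gets total degree 0.\<close>

definition mpoly_total_degree :: "'i real_mpoly \<Rightarrow> nat" where
  "mpoly_total_degree p =
     Max (insert 0 ((\<lambda>m. \<Sum>i \<in> Poly_Mapping.keys m. Poly_Mapping.lookup m i) `
                      Poly_Mapping.keys p))"

text \<open>The variables of a polynomial response function at \<open>v\<close> are the scalar inputs: the pair
  \<open>(h, i)\<close> stands for the entry with (zero-based) index \<open>i\<close> of the vector belonging to \<open>h\<close>.
  Since the real field is infinite, \<open>G\<close> determines \<open>p\<close>, and hence \<open>d\<close>, uniquely.\<close>

definition polynomial_response ::
    "('v, 'h, 's, 't) hypernet \<Rightarrow> 'v \<Rightarrow> (('h \<Rightarrow> real list) \<Rightarrow> real) \<Rightarrow> nat \<Rightarrow> bool" where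
  "polynomial_response N v G d \<longleftrightarrow>
     (\<exists>p :: ('h \<times> nat) real_mpoly.
        mpoly_vars p \<subseteq> (SIGMA h : in_edges N v. {..<length (src N h)}) \<and>
        mpoly_total_degree p = d \<and>
        (\<forall>X \<in> input_space N v. G X = mpoly_eval p (\<lambda>(h, i). X h ! i)))"


section \<open>The augmented hypernetwork\<close>

text \<open>The types of the new vertices and hyperedges. That the two self-loops share one type, which
  is different from all others, is forced by the axioms of a hypernetwork.\<close>

datatype 'v aug_vertex = Core 'v | W nat
datatype 'h aug_edge = Core_edge 'h | Loop nat | Perm_edge "nat \<Rightarrow> nat"
datatype 's aug_vtype = Core_vtype 's | W_type
datatype 't aug_htype = Core_htype 't | Loop_type | Perm_type

definition parity_index :: "(nat \<Rightarrow> nat) \<Rightarrow> nat" where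
  "parity_index \<sigma> = (if evenperm \<sigma> then 0 else 1)"

text \<open>The argument \<open>\<nu>\<close> enumerates the vertices of the core as \<open>\<nu> 0, \<dots>, \<nu> k\<close>.\<close>

definition augmented ::
    "('v, 'h, 's, 't) hypernet \<Rightarrow> nat \<Rightarrow> (nat \<Rightarrow> 'v) \<Rightarrow>
     ('v aug_vertex, 'h aug_edge, 's aug_vtype, 't aug_htype) hypernet" where
  "augmented N k \<nu> = \<lparr>
     verts = Core ` verts N \<union> {W 0, W 1},
     hedges = Core_edge ` hedges N \<union> {Loop 0, Loop 1} \<union> Perm_edge ` {\<sigma>. \<sigma> permutes {0..k}},
     src = (\<lambda>e. case e of
         Core_edge h \<Rightarrow> map Core (src N h)
       | Loop j \<Rightarrow> [W j]
       | Perm_edge \<sigma> \<Rightarrow> map (\<lambda>i. Core (\<nu> (\<sigma> i))) [1..<Suc k]),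
     tgt = (\<lambda>e. case e of
         Core_edge h \<Rightarrow> Core (tgt N h)
       | Loop j \<Rightarrow> W j
       | Perm_edge \<sigma> \<Rightarrow> W (parity_index \<sigma>)),
     vtype = (\<lambda>a. case a of Core v \<Rightarrow> Core_vtype (vtype N v) | W j \<Rightarrow> W_type),
     htype = (\<lambda>e. case e of
         Core_edge h \<Rightarrow> Core_htype (htype N h)
       | Loop j \<Rightarrow> Loop_type
       | Perm_edge \<sigma> \<Rightarrow> Perm_type) \<rparr>"

definition w_synchrony_space ::
    "('v aug_vertex, 'h, 's, 't) hypernet \<Rightarrow> ('v aug_vertex \<Rightarrow> real) set" where
  "w_synchrony_space N = {x \<in> state_space N. x (W 0) = x (W 1)}"


section \<open>Well-definedness of the augmented hypernetwork\<close>

lemma in_edges_augmented_W: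
  assumes "j \<in> {0, 1}"
  shows "in_edges (augmented N k \<nu>) (W j) =
           insert (Loop j) (Perm_edge ` {\<sigma>. \<sigma> permutes {0..k} \<and> parity_index \<sigma> = j})"
  using assms by (auto simp: in_edges_def augmented_def)

lemma in_edges_augmented_Core:
  "in_edges (augmented N k \<nu>) (Core v) = Core_edge ` in_edges N v"
  by (auto simp: in_edges_def augmented_def)

lemma vector_field_augmented_W:
  assumes "j \<in> {0, 1}"
  shows "vector_field (augmented N k \<nu>) F x (W j) =
           F (W j) (\<lambda>e \<in> insert (Loop j) (Perm_edge ` {\<sigma>. \<sigma> permutes {0..k} \<and> parity_index \<sigma> = j}).
             case e of Loop i \<Rightarrow> [x (W i)]
               | Perm_edge \<sigma> \<Rightarrow> map (\<lambda>i. x (Core (\<nu> (\<sigma> i)))) [1..<Suc k])"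
proof -
  have "W j \<in> verts (augmented N k \<nu>)"
    using assms by (auto simp: augmented_def)
  moreover have "(\<lambda>e \<in> insert (Loop j) (Perm_edge ` {\<sigma>. \<sigma> permutes {0..k} \<and> parity_index \<sigma> = j}).
        map x (src (augmented N k \<nu>) e)) =
      (\<lambda>e \<in> insert (Loop j) (Perm_edge ` {\<sigma>. \<sigma> permutes {0..k} \<and> parity_index \<sigma> = j}).
        case e of Loop i \<Rightarrow> [x (W i)]
          | Perm_edge \<sigma> \<Rightarrow> map (\<lambda>i. x (Core (\<nu> (\<sigma> i)))) [1..<Suc k])"
    by (rule restrict_ext) (auto simp: augmented_def)
  ultimately show ?thesis
    by (simp only: vector_field_def in_edges_augmented_W[OF assms] restrict_apply' if_True)
qed

lemma bij_betw_parity_classes: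
  assumes "1 \<le> k" "i \<in> {0, 1}" "j \<in> {0, 1}"
  shows "\<exists>\<beta>. bij_betw \<beta> {\<sigma>. \<sigma> permutes {0..k} \<and> parity_index \<sigma> = i}
                        {\<sigma>. \<sigma> permutes {0..k} \<and> parity_index \<sigma> = j}"
proof (cases "i = j")
  case True
  then show ?thesis by (auto intro: exI[of _ id])
next
  case False
  define t where "t = Transposition.transpose (0::nat) 1"
  have t: "t permutes {0..k}" "t \<circ> t = id" "\<not> evenperm t" "permutation t"
    using assms(1) unfolding t_def
    by (auto intro!: permutes_swap_id permutation_swap_id simp: evenperm_swap)
  have step: "t \<circ> \<sigma> permutes {0..k} \<and> parity_index (t \<circ> \<sigma>) = 1 - parity_index \<sigma>"
    if "\<sigma> permutes {0..k}" for \<sigma>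
  proof -
    have "permutation \<sigma>" using that by (auto simp: permutation_permutes)
    then show ?thesis
      using t that by (auto simp: parity_index_def evenperm_comp permutes_compose)
  qed
  have inv: "t \<circ> (t \<circ> \<sigma>) = \<sigma>" for \<sigma> using t(2) by (metis comp_assoc id_comp)
  have ij: "1 - i = j" "1 - j = i" using False assms by auto
  show ?thesis
    by (rule exI[of _ "(\<circ>) t"], rule bij_betw_byWitness[where f' = "(\<circ>) t"])
       (use step inv ij in auto)
qed

lemma hypernetwork_augmented:
  assumes N: "hypernetwork N" and k: "2 \<le> k" and \<nu>: "bij_betw \<nu> {0..k} (verts N)"
    and eq: "\<forall>u \<in> verts N. \<forall>v \<in> verts N. vtype N u = vtype N v"
  shows "hypernetwork (augmented N k \<nu>)"
proof -
  let ?A = "augmented N k \<nu>"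
  have node: "\<nu> (\<sigma> i) \<in> verts N" if "\<sigma> permutes {0..k}" "i \<le> k" for \<sigma> i
  proof -
    have "\<sigma> i \<in> {0..k}" using that permutes_in_image[OF that(1), of i] by simp
    then show ?thesis using \<nu> by (auto simp: bij_betw_def)
  qed
  have fin: "finite (verts ?A)" "finite (hedges ?A)"
    using N by (auto simp: hypernetwork_def augmented_def finite_permutations)
  have st: "set (src ?A h) \<subseteq> verts ?A \<and> tgt ?A h \<in> verts ?A" if "h \<in> hedges ?A" for h
  proof (cases h)
    case (Core_edge a)
    then have a: "a \<in> hedges N" using that by (auto simp: augmented_def)
    then have "set (src N a) \<subseteq> verts N" "tgt N a \<in> verts N"
      using N by (auto simp: hypernetwork_def)
    then show ?thesis using Core_edge by (auto simp: augmented_def)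
  qed (use that node in \<open>auto simp: augmented_def parity_index_def\<close>)
  have ty: "length (src ?A g) = length (src ?A h) \<and>
        (\<forall>i < length (src ?A g). vtype ?A (src ?A g ! i) = vtype ?A (src ?A h ! i)) \<and>
        vtype ?A (tgt ?A g) = vtype ?A (tgt ?A h)"
    if "g \<in> hedges ?A" "h \<in> hedges ?A" "htype ?A g = htype ?A h" for g h
  proof (cases g)
    case (Core_edge a)
    with that obtain b where b: "h = Core_edge b"
      by (cases h) (auto simp: augmented_def)
    have ab: "a \<in> hedges N" "b \<in> hedges N" "htype N a = htype N b"
      using that Core_edge b by (auto simp: augmented_def)
    have len: "length (src N a) = length (src N b)"
      and "\<forall>i < length (src N a). vtype N (src N a ! i) = vtype N (src N b ! i)"
      and "vtype N (tgt N a) = vtype N (tgt N b)"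
      using N ab unfolding hypernetwork_def by blast+
    then show ?thesis unfolding Core_edge b by (simp add: augmented_def)
  next
    case (Loop a)
    with that obtain b where b: "h = Loop b"
      by (cases h) (auto simp: augmented_def)
    show ?thesis using Loop b by (auto simp: augmented_def)
  next
    case (Perm_edge a)
    with that obtain b where b: "h = Perm_edge b"
      by (cases h) (auto simp: augmented_def)
    have "a permutes {0..k}" "b permutes {0..k}"
      using that Perm_edge b by (auto simp: augmented_def)
    then have "vtype N (\<nu> (a i)) = vtype N (\<nu> (b i))" if "i \<le> k" for i
      using that eq node by blast
    then show ?thesis unfolding Perm_edge b
      by (simp add: augmented_def del: upt_Suc)
  qed
  have bij: "\<exists>\<alpha>. type_bij ?A a b \<alpha>"
    if "a \<in> verts ?A" "b \<in> verts ?A" "vtype ?A a = vtype ?A b" for a b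
  proof (cases a)
    case (Core u)
    with that obtain w where w: "b = Core w"
      by (cases b) (auto simp: augmented_def)
    have "u \<in> verts N" "w \<in> verts N" "vtype N u = vtype N w"
      using that Core w by (auto simp: augmented_def)
    then obtain \<beta> where \<beta>: "type_bij N u w \<beta>"
      using N unfolding hypernetwork_def by blast
    define \<alpha> where "\<alpha> = (\<lambda>e. case e of Core_edge h \<Rightarrow> Core_edge (\<beta> h) | _ \<Rightarrow> e)"
    have "type_bij ?A a b \<alpha>"
      using \<beta> unfolding type_bij_def Core w in_edges_augmented_Core bij_betw_def
      by (auto simp: \<alpha>_def inj_on_def augmented_def image_image)
    then show ?thesis by blast
  next
    case (W i)
    with that obtain j where j: "b = W j"
      by (cases b) (auto simp: augmented_def)
    have ij: "i \<in> {0, 1}" "j \<in> {0, 1}" using that W j by (auto simp: augmented_def)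
    obtain \<beta> where \<beta>: "bij_betw \<beta> {\<sigma>. \<sigma> permutes {0..k} \<and> parity_index \<sigma> = i}
                        {\<sigma>. \<sigma> permutes {0..k} \<and> parity_index \<sigma> = j}"
      using bij_betw_parity_classes[OF _ ij, of k] k by auto
    define \<alpha> :: "'b aug_edge \<Rightarrow> 'b aug_edge"
      where "\<alpha> = (\<lambda>e. case e of Perm_edge h \<Rightarrow> Perm_edge (\<beta> h) | _ \<Rightarrow> Loop j)"
    let ?P = "\<lambda>i. {\<sigma>. \<sigma> permutes {0..k} \<and> parity_index \<sigma> = i}"
    have "inj_on \<beta> (?P i)" and im: "\<beta> ` ?P i = ?P j"
      using \<beta> by (auto simp: bij_betw_def)
    then have "inj_on \<alpha> (insert (Loop i) (Perm_edge ` ?P i))"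
      by (auto simp: \<alpha>_def inj_on_def)
    moreover have "\<alpha> ` insert (Loop i) (Perm_edge ` ?P i) = insert (Loop j) (Perm_edge ` ?P j)"
      unfolding im[symmetric] by (simp add: \<alpha>_def image_image)
    moreover have "htype ?A (\<alpha> h) = htype ?A h"
      if "h \<in> insert (Loop i) (Perm_edge ` ?P i)" for h
      using that by (auto simp: \<alpha>_def augmented_def)
    ultimately have "type_bij ?A a b \<alpha>"
      unfolding type_bij_def W j in_edges_augmented_W[OF ij(1)] in_edges_augmented_W[OF ij(2)]
        bij_betw_def by blast
    then show ?thesis by blast
  qed
  show ?thesis
    unfolding hypernetwork_def using fin st ty bij by blast
qed

end

theory Submission
  imports Defs "HOL-Computational_Algebra.Polynomial"
begin

text \<open>On \<open>y\<^sub>0 = y\<^sub>1\<close> the response of \<open>w\<^sub>0\<close>, read as a function of the core states and composed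
  with a permutation \<open>\<tau>\<close> of these states, becomes the response of the node with index
  \<open>sgn \<tau>\<close>. Hence its alternating sum over all \<open>\<tau>\<close> is a positive multiple of the difference
  of the two \<open>y\<close>-equations. The alternating sum of a monomial with two equal exponents vanishes,
  and \<open>k + 1\<close> distinct exponents add up to at least \<open>0 + 1 + \<dots> + k\<close>, so the difference is zero
  below that degree. In that degree, summing \<open>X\<^sub>1 X\<^sub>2\<^sup>2 \<dots> X\<^sub>k\<^sup>k\<close> over the vector inputs gives the
  Vandermonde determinant as the difference; at \<open>x\<^sub>j = t\<^sup>j\<close> it is a nonzero polynomial in \<open>t\<close>.\<close>

section \<open>Alternating sums of monomials of low degree\<close>

text \<open>Right composition with the transposition permutes the summands, fixes \<open>g\<close>
  and flips every sign, so the sum equals its own negative.\<close>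

lemma sum_sign_comp_transpose_invariant_eq_0:
  fixes g :: "('a \<Rightarrow> 'a) \<Rightarrow> real"
  assumes S: "finite S" "a \<in> S" "b \<in> S" "a \<noteq> b"
    and g: "\<And>\<tau>. \<tau> permutes S \<Longrightarrow> g (\<tau> \<circ> transpose a b) = g \<tau>"
  shows "(\<Sum>\<tau> | \<tau> permutes S. of_int (sign \<tau>) * g \<tau>) = 0"
proof -
  have t: "transpose a b permutes S"
    using S by (intro permutes_swap_id)
  have "(\<Sum>\<tau> | \<tau> permutes S. of_int (sign \<tau>) * g \<tau>) =
      (\<Sum>\<tau> | \<tau> permutes S. of_int (sign (\<tau> \<circ> transpose a b)) * g (\<tau> \<circ> transpose a b))"
    by (rule sum_permutations_compose_right[OF t])
  also have "\<dots> = (\<Sum>\<tau> | \<tau> permutes S. - (of_int (sign \<tau>) * g \<tau>))"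
  proof (rule sum.cong[OF refl])
    fix \<tau> assume "\<tau> \<in> {\<tau>. \<tau> permutes S}"
    then have \<tau>: "\<tau> permutes S" by simp
    then have "permutation \<tau>" using S(1) permutation_permutes by blast
    then have "sign (\<tau> \<circ> transpose a b) = - sign \<tau>"
      using S(4) by (simp add: sign_compose permutation_swap_id sign_swap_id)
    then show "of_int (sign (\<tau> \<circ> transpose a b)) * g (\<tau> \<circ> transpose a b) =
        - (of_int (sign \<tau>) * g \<tau>)"
      using g[OF \<tau>] by simp
  qed
  finally show ?thesis by (simp add: sum_negf)
qed

lemma sum_sign_monomial_eq_0:
  fixes u :: "'a \<Rightarrow> real"
  assumes S: "finite S" and e: "sum e S < \<Sum>{0..<card S}"
  shows "(\<Sum>\<tau> | \<tau> permutes S. of_int (sign \<tau>) * (\<Prod>j\<in>S. u (\<tau> j) ^ e j)) = 0"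
proof -
  have "\<not> inj_on e S"
  proof
    assume inj: "inj_on e S"
    have "\<Sum>{0..<card (e ` S)} \<le> \<Sum>(e ` S)"
      by (rule card_sum_le_nat_sum)
    with inj e show False by (simp add: card_image sum.reindex)
  qed
  then obtain a b where ab: "a \<in> S" "b \<in> S" "a \<noteq> b" "e a = e b"
    by (auto simp: inj_on_def)
  show ?thesis
  proof (rule sum_sign_comp_transpose_invariant_eq_0[OF S ab(1-3)])
    fix \<tau>
    \<comment> \<open>Reindexing the product by the transposition moves it from the values to the
      exponents as well, where it has no effect because \<open>e a = e b\<close>.\<close>
    have "(\<Prod>j\<in>S. u (\<tau> j) ^ e j) =
        (\<Prod>j\<in>S. u (\<tau> (transpose a b j)) ^ e (transpose a b j))"
      using prod.permute[OF permutes_swap_id[OF ab(1,2)], of "\<lambda>j. u (\<tau> j) ^ e j"]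
      by (simp add: o_def)
    moreover have "e (transpose a b j) = e j" for j
      using ab(4) by (auto simp: transpose_def)
    ultimately show "(\<Prod>j\<in>S. u ((\<tau> \<circ> transpose a b) j) ^ e j) = (\<Prod>j\<in>S. u (\<tau> j) ^ e j)"
      by simp
  qed
qed

text \<open>Several scalar inputs carry the same core state. Collecting them turns a monomial in the
  inputs into a monomial in the states, with exponents added over each fibre of
  \<open>f\<close>.\<close>

lemma prod_power_group:
  fixes g :: "'a \<Rightarrow> 'b :: comm_monoid_mult"
  assumes "finite K" "finite S" "f ` K \<subseteq> S"
  shows "(\<Prod>q\<in>K. g (f q) ^ m q) = (\<Prod>j\<in>S. g j ^ (\<Sum>q | q \<in> K \<and> f q = j. m q))"
  by (simp add: prod.group[OF assms, symmetric] power_sum)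

lemma sum_lookup_le_mpoly_total_degree:
  assumes "m \<in> Poly_Mapping.keys p"
  shows "(\<Sum>i\<in>Poly_Mapping.keys m. Poly_Mapping.lookup m i) \<le> mpoly_total_degree p"
  using assms unfolding mpoly_total_degree_def by (intro Max_ge) auto

lemma mpoly_eval_cong:
  assumes "\<And>i. i \<in> mpoly_vars p \<Longrightarrow> x i = y i"
  shows "mpoly_eval p x = mpoly_eval p y"
  unfolding mpoly_eval_def
  by (intro sum.cong prod.cong arg_cong2[where f = "(*)"] arg_cong2[where f = "(^)"] refl assms)
     (auto simp: mpoly_vars_def)

text \<open>The variables outside \<open>L\<close> are substituted by the permuted values \<open>u\<close>. Each monomial then
  becomes a monomial in \<open>u\<close> whose degree is too small for its exponents to be distinct.\<close>

lemma sum_sign_mpoly_eval_eq_0: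
  fixes p :: "'i real_mpoly" and u :: "'a \<Rightarrow> real"
  assumes S: "finite S" and deg: "mpoly_total_degree p < \<Sum>{0..<card S}"
    and f: "f ` (mpoly_vars p - L) \<subseteq> S"
  shows "(\<Sum>\<tau> | \<tau> permutes S.
      of_int (sign \<tau>) * mpoly_eval p (\<lambda>i. if i \<in> L then c i else u (\<tau> (f i)))) = 0"
proof -
  let ?z = "\<lambda>\<tau> i. if i \<in> L then c i else u (\<tau> (f i))"
  let ?mon = "\<lambda>m \<tau>. \<Prod>i\<in>Poly_Mapping.keys m. ?z \<tau> i ^ Poly_Mapping.lookup m i"
  have monomial: "(\<Sum>\<tau> | \<tau> permutes S. of_int (sign \<tau>) * ?mon m \<tau>) = 0"
    if m: "m \<in> Poly_Mapping.keys p" for m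
  proof -
    \<comment> \<open>Only the variables in \<open>K\<close> see \<tau>, and \<open>e j\<close> is
      the total exponent of \<open>u (\<tau> j)\<close>. The factor \<open>C\<close> is independent
      of \<tau> and comes out of the alternating sum.\<close>
    define K where "K = Poly_Mapping.keys m - L"
    define e where "e j = (\<Sum>q | q \<in> K \<and> f q = j. Poly_Mapping.lookup m q)" for j
    define C where "C = (\<Prod>i\<in>Poly_Mapping.keys m \<inter> L. c i ^ Poly_Mapping.lookup m i)"
    have K: "finite K" "f ` K \<subseteq> S"
      using f m by (auto simp: K_def mpoly_vars_def)
    have "?mon m \<tau> = C * (\<Prod>j\<in>S. u (\<tau> j) ^ e j)" for \<tau>
    proof -
      have "?mon m \<tau> = (\<Prod>i\<in>Poly_Mapping.keys m \<inter> L. ?z \<tau> i ^ Poly_Mapping.lookup m i) *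
          (\<Prod>i\<in>K. ?z \<tau> i ^ Poly_Mapping.lookup m i)"
        unfolding K_def by (rule prod.Int_Diff) simp
      also have "(\<Prod>i\<in>K. ?z \<tau> i ^ Poly_Mapping.lookup m i) =
          (\<Prod>i\<in>K. u (\<tau> (f i)) ^ Poly_Mapping.lookup m i)"
        by (intro prod.cong) (auto simp: K_def)
      also have "\<dots> = (\<Prod>j\<in>S. u (\<tau> j) ^ e j)"
        unfolding e_def by (rule prod_power_group[OF K(1) S K(2)])
      finally show ?thesis by (simp add: C_def)
    qed
    moreover have "sum e S < \<Sum>{0..<card S}"
    proof -
      have "sum e S = (\<Sum>q\<in>K. Poly_Mapping.lookup m q)"
        unfolding e_def by (rule sum.group[OF K(1) S K(2)])
      also have "\<dots> \<le> (\<Sum>q\<in>Poly_Mapping.keys m. Poly_Mapping.lookup m q)"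
        by (rule sum_mono2) (auto simp: K_def)
      also have "\<dots> \<le> mpoly_total_degree p"
        by (rule sum_lookup_le_mpoly_total_degree[OF m])
      finally show ?thesis using deg by simp
    qed
    ultimately show ?thesis
      using sum_sign_monomial_eq_0[OF S, of e u]
      by (simp add: mult.left_commute sum_distrib_left[symmetric])
  qed
  have "(\<Sum>\<tau> | \<tau> permutes S. of_int (sign \<tau>) * mpoly_eval p (?z \<tau>)) =
      (\<Sum>m\<in>Poly_Mapping.keys p. Poly_Mapping.lookup p m *
        (\<Sum>\<tau> | \<tau> permutes S. of_int (sign \<tau>) * ?mon m \<tau>))"
    unfolding mpoly_eval_def sum_distrib_left
    by (subst sum.swap) (simp add: mult.left_commute)
  then show ?thesis by (simp add: monomial)
qed

section \<open>Type-preserving bijections between the inputs of the y-nodes\<close>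

lemma parity_index_in: "parity_index \<sigma> \<in> {0, 1}"
  by (simp add: parity_index_def)

lemma parity_index_comp:
  assumes "\<sigma> permutes {0..k}" "\<tau> permutes {0..k}"
  shows "parity_index (\<tau> \<circ> \<sigma>) = (if parity_index \<sigma> = 0 then parity_index \<tau> else 1 - parity_index \<tau>)"
proof -
  have "permutation \<sigma>" "permutation \<tau>"
    using assms permutation_permutes by blast+
  then show ?thesis by (simp add: parity_index_def evenperm_comp)
qed

text \<open>Composition is on the left because \<open>\<tau> \<circ> \<sigma>\<close> reads the core
  states in the order of \<sigma> after relabelling them by \<tau>. The default branch of \<alpha>
  matters only for the loop, since no core edge targets a y-node.\<close>

lemma type_bij_augmented_comp:
  fixes N :: "('v, 'h, 's, 't) hypernet"
  assumes \<tau>: "\<tau> permutes {0..k}"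
  defines "\<alpha> \<equiv> \<lambda>e. case e of Perm_edge \<sigma> \<Rightarrow> Perm_edge (\<tau> \<circ> \<sigma>) | _ \<Rightarrow> Loop (parity_index \<tau>)"
  shows "type_bij (augmented N k \<nu>) (W 0) (W (parity_index \<tau>)) \<alpha>"
proof -
  let ?P = "\<lambda>i. {\<sigma>. \<sigma> permutes {0..k} \<and> parity_index \<sigma> = i}"
  have inv: "inv \<tau> \<circ> \<tau> = id" "\<tau> \<circ> inv \<tau> = id"
    using \<tau> by (simp_all add: permutes_inv_o)
  have comp: "\<tau> \<circ> \<sigma> \<in> ?P (parity_index \<tau>) \<longleftrightarrow> \<sigma> \<in> ?P 0" if "\<sigma> permutes {0..k}" for \<sigma>
    using parity_index_comp[OF that \<tau>] parity_index_in[of \<tau>] parity_index_in[of \<sigma>]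
      permutes_compose[OF that \<tau>] that by auto
  have "bij_betw ((\<circ>) \<tau>) (?P 0) (?P (parity_index \<tau>))"
  proof (rule bij_betw_byWitness[where f' = "(\<circ>) (inv \<tau>)"])
    show "(\<circ>) (inv \<tau>) ` ?P (parity_index \<tau>) \<subseteq> ?P 0"
    proof safe
      fix \<sigma> assume \<sigma>: "\<sigma> permutes {0..k}" "parity_index \<sigma> = parity_index \<tau>"
      then have "inv \<tau> \<circ> \<sigma> permutes {0..k}"
        using \<tau> by (simp add: permutes_compose permutes_inv)
      moreover from this have "inv \<tau> \<circ> \<sigma> \<in> ?P 0"
        using comp[of "inv \<tau> \<circ> \<sigma>"] \<sigma> inv by (simp add: o_assoc)
      ultimately show "inv \<tau> \<circ> \<sigma> permutes {0..k}" "parity_index (inv \<tau> \<circ> \<sigma>) = 0" by auto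
    qed
  qed (use inv comp in \<open>auto simp: o_assoc\<close>)
  then have "inj_on ((\<circ>) \<tau>) (?P 0)" and im: "(\<circ>) \<tau> ` ?P 0 = ?P (parity_index \<tau>)"
    by (auto simp: bij_betw_def)
  then have "inj_on \<alpha> (insert (Loop 0) (Perm_edge ` ?P 0))"
    by (auto simp: \<alpha>_def inj_on_def)
  moreover have "\<alpha> ` insert (Loop 0) (Perm_edge ` ?P 0) =
      insert (Loop (parity_index \<tau>)) (Perm_edge ` ?P (parity_index \<tau>))"
    unfolding im[symmetric] by (simp add: \<alpha>_def image_image)
  moreover have "htype (augmented N k \<nu>) (\<alpha> h) = htype (augmented N k \<nu>) h"
    if "h \<in> insert (Loop 0) (Perm_edge ` ?P 0)" for h
    using that by (auto simp: \<alpha>_def augmented_def)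
  ultimately show ?thesis
    unfolding type_bij_def bij_betw_def in_edges_augmented_W[OF parity_index_in]
      in_edges_augmented_W[of 0, simplified]
    by blast
qed

text \<open>The critical degree is the least possible sum of \<open>k + 1\<close> distinct
  exponents, one for each core node.\<close>

lemma sum_atLeast0LessThan_card_atLeastAtMost: "\<Sum>{0..<card {0..k}} = k * (k + 1) div 2"
  by (simp add: atLeastLessThanSuc_atLeastAtMost gauss_sum_nat mult.commute)

section \<open>Equality of the y-equations below the critical degree\<close>

lemma vector_field_W_eq:
  fixes N :: "('v, 'h, 's, 't) hypernet" and k :: nat and \<nu> :: "nat \<Rightarrow> 'v"
  defines "A \<equiv> augmented N k \<nu>"
  assumes k: "1 \<le> k"
    and F: "response_functions A F" and poly: "polynomial_response A (W 0) (F (W 0)) d"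
    and d: "d < k * (k + 1) div 2" and y: "x (W 0) = x (W 1)"
  shows "vector_field A F x (W 0) = vector_field A F x (W 1)"
proof -
  define u where "u j = x (Core (\<nu> j))" for j
  \<comment> \<open>\<open>X \<tau>\<close> is the input of w_0 after the core states are permuted
    by \<tau>, with the loop entry kept fixed.\<close>
  define X where "X \<tau> = (\<lambda>e \<in> in_edges A (W 0). case e of Loop i \<Rightarrow> [x (W 0)]
      | Perm_edge \<sigma> \<Rightarrow> map (\<lambda>i. u (\<tau> (\<sigma> i))) [1..<Suc k])" for \<tau>
  obtain p :: "('h aug_edge \<times> nat) real_mpoly" where
    vars: "mpoly_vars p \<subseteq> (SIGMA h : in_edges A (W 0). {..<length (src A h)})" and
    deg: "mpoly_total_degree p = d" and
    p: "\<And>X. X \<in> input_space A (W 0) \<Longrightarrow> F (W 0) X = mpoly_eval p (\<lambda>(h, i). X h ! i)"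
    using poly unfolding polynomial_response_def by blast
  \<comment> \<open>The loop entry is the one variable that \<tau> does not affect. On the others
    \<open>f\<close> gives the index of the core state: the entry at zero-based position
    \<open>i\<close> belongs to \<open>\<sigma> (Suc i)\<close>, since source lists start with
    \<open>\<sigma> 1\<close>. The value 0 of \<open>f\<close> is a dummy.\<close>
  define L where "L = {(Loop 0 :: 'h aug_edge, 0 :: nat)}"
  define f :: "'h aug_edge \<times> nat \<Rightarrow> nat" where "f = (\<lambda>(h, i). case h of Perm_edge \<sigma> \<Rightarrow> \<sigma> (Suc i) | _ \<Rightarrow> 0)"
  have edges: "in_edges A (W 0) =
      insert (Loop 0) (Perm_edge ` {\<sigma>. \<sigma> permutes {0..k} \<and> parity_index \<sigma> = 0})"
    unfolding A_def by (rule in_edges_augmented_W) simp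
  have src: "src A (Loop j) = [W j]" "src A (Perm_edge \<sigma>) = map (\<lambda>i. Core (\<nu> (\<sigma> i))) [1..<Suc k]"
    for j \<sigma>
    by (simp_all add: A_def augmented_def)
  have in_f: "f ` (mpoly_vars p - L) \<subseteq> {0..k}"
  proof
    fix j assume "j \<in> f ` (mpoly_vars p - L)"
    then obtain h i where hi: "j = f (h, i)" "(h, i) \<notin> L" "h \<in> in_edges A (W 0)" "i < length (src A h)"
      using vars by fastforce
    then obtain \<sigma> where \<sigma>: "h = Perm_edge \<sigma>" "\<sigma> permutes {0..k}" "i < k"
      by (auto simp: edges src L_def simp del: upt_Suc)
    then show "j \<in> {0..k}"
      using permutes_in_image[OF \<sigma>(2), of "Suc i"] by (simp add: hi(1) f_def)
  qed
  have value_X: "F (W 0) (X \<tau>) = mpoly_eval p (\<lambda>i. if i \<in> L then x (W 0) else u (\<tau> (f i)))" for \<tau>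
  proof -
    have "X \<tau> \<in> input_space A (W 0)"
      by (auto simp: input_space_def X_def edges src simp del: upt_Suc)
    then have "F (W 0) (X \<tau>) = mpoly_eval p (\<lambda>(h, i). X \<tau> h ! i)" by (rule p)
    also have "\<dots> = mpoly_eval p (\<lambda>i. if i \<in> L then x (W 0) else u (\<tau> (f i)))"
    proof (rule mpoly_eval_cong)
      fix q assume "q \<in> mpoly_vars p"
      then obtain h i where "q = (h, i)" "h \<in> in_edges A (W 0)" "i < length (src A h)"
        using vars by fastforce
      then show "(case q of (h, i) \<Rightarrow> X \<tau> h ! i) =
          (if q \<in> L then x (W 0) else u (\<tau> (f q)))"
        by (auto simp: X_def edges src L_def f_def simp del: upt_Suc)
    qed
    finally show ?thesis .
  qed
  have transport: "F (W 0) (X \<tau>) = vector_field A F x (W (parity_index \<tau>))"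
    if \<tau>: "\<tau> permutes {0..k}" for \<tau>
  proof -
    define \<alpha> :: "'h aug_edge \<Rightarrow> 'h aug_edge"
      where "\<alpha> = (\<lambda>e. case e of Perm_edge \<sigma> \<Rightarrow> Perm_edge (\<tau> \<circ> \<sigma>) | _ \<Rightarrow> Loop (parity_index \<tau>))"
    define Y where "Y = (\<lambda>h \<in> in_edges A (W (parity_index \<tau>)). map x (src A h))"
    have bij: "type_bij A (W 0) (W (parity_index \<tau>)) \<alpha>"
      unfolding A_def \<alpha>_def by (rule type_bij_augmented_comp[OF \<tau>])
    have verts: "W 0 \<in> verts A" "W (parity_index \<tau>) \<in> verts A"
      "vtype A (W 0) = vtype A (W (parity_index \<tau>))"
      using parity_index_in[of \<tau>] by (auto simp: A_def augmented_def)
    have "Y \<in> input_space A (W (parity_index \<tau>))"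
      by (simp add: Y_def input_space_def)
    then have "F (W (parity_index \<tau>)) Y = F (W 0) (\<lambda>h \<in> in_edges A (W 0). Y (\<alpha> h))"
      using F verts bij unfolding response_functions_def by blast
    also have "(\<lambda>h \<in> in_edges A (W 0). Y (\<alpha> h)) = X \<tau>"
      unfolding X_def
    proof (rule restrict_ext)
      fix h assume h: "h \<in> in_edges A (W 0)"
      then have "\<alpha> h \<in> in_edges A (W (parity_index \<tau>))"
        using bij unfolding type_bij_def bij_betw_def by blast
      then have "Y (\<alpha> h) = map x (src A (\<alpha> h))" by (simp add: Y_def)
      \<comment> \<open>For odd \<tau> the loop entry of \<open>Y\<close> is \<open>x (W 1)\<close>;
        this is where \<open>y\<close> enters.\<close>
      also have "\<dots> = (case h of Loop i \<Rightarrow> [x (W 0)]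
          | Perm_edge \<sigma> \<Rightarrow> map (\<lambda>i. u (\<tau> (\<sigma> i))) [1..<Suc k])"
        using h y by (auto simp: edges \<alpha>_def src u_def parity_index_def simp del: upt_Suc)
      finally show "Y (\<alpha> h) = (case h of Loop i \<Rightarrow> [x (W 0)]
          | Perm_edge \<sigma> \<Rightarrow> map (\<lambda>i. u (\<tau> (\<sigma> i))) [1..<Suc k])" .
    qed
    finally show ?thesis
      using verts by (simp add: vector_field_def flip: Y_def)
  qed
  let ?P = "\<lambda>i. {\<sigma>. \<sigma> permutes {0..k} \<and> parity_index \<sigma> = i}"
  have fin: "finite {\<tau>. \<tau> permutes {0..k}}" by (simp add: finite_permutations)
  then have finP: "finite (?P i)" for i by simp
  \<comment> \<open>The degree bound makes the alternating sum vanish; \<open>transport\<close> then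
    evaluates the same sum through the two y-components.\<close>
  have "0 = (\<Sum>\<tau> | \<tau> permutes {0..k}. of_int (sign \<tau>) * F (W 0) (X \<tau>))"
    unfolding value_X
    by (rule sum_sign_mpoly_eval_eq_0[symmetric])
       (use d deg sum_atLeast0LessThan_card_atLeastAtMost[of k] in_f in simp_all)
  also have "\<dots> = (\<Sum>\<tau> | \<tau> permutes {0..k}.
      of_int (sign \<tau>) * vector_field A F x (W (parity_index \<tau>)))"
    by (intro sum.cong) (auto simp: transport)
  also have "{\<tau>. \<tau> permutes {0..k}} = ?P 0 \<union> ?P 1"
    using parity_index_in by auto
  also have "(\<Sum>\<tau> \<in> ?P 0 \<union> ?P 1. of_int (sign \<tau>) * vector_field A F x (W (parity_index \<tau>))) =
      (\<Sum>\<tau> \<in> ?P 0. of_int (sign \<tau>) * vector_field A F x (W (parity_index \<tau>))) +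
      (\<Sum>\<tau> \<in> ?P 1. of_int (sign \<tau>) * vector_field A F x (W (parity_index \<tau>)))"
    by (rule sum.union_disjoint) (auto simp: finP)
  also have "\<dots> = (\<Sum>\<tau> \<in> ?P 0. vector_field A F x (W 0)) + (\<Sum>\<tau> \<in> ?P 1. - vector_field A F x (W 1))"
    by (intro arg_cong2[where f = "(+)"] sum.cong)
       (auto simp: parity_index_def sign_def split: if_splits)
  \<comment> \<open>Equally many even and odd permutations turn the two constant sums into a
    multiple of the difference; the factor is nonzero because \<open>id\<close> is even.\<close>
  also have "card (?P 1) = card (?P 0)"
    using bij_betw_parity_classes[of k 1 0] k by (auto dest: bij_betw_same_card)
  then have "(\<Sum>\<tau> \<in> ?P 0. vector_field A F x (W 0)) + (\<Sum>\<tau> \<in> ?P 1. - vector_field A F x (W 1)) =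
      real (card (?P 0)) * (vector_field A F x (W 0) - vector_field A F x (W 1))"
    by (simp add: right_diff_distrib)
  finally have "card (?P 0) = 0 \<or> vector_field A F x (W 0) = vector_field A F x (W 1)"
    by simp
  moreover have "id \<in> ?P 0" by (simp add: parity_index_def permutes_id)
  then have "card (?P 0) \<noteq> 0" using finP[of 0] by (metis card_0_eq empty_iff)
  ultimately show ?thesis by blast
qed

section \<open>A response of critical degree that breaks the synchrony\<close>

text \<open>With \<open>T = Perm_type\<close>, w_0 and w_1 receive the even and the odd half of the
  Leibniz expansion of the Vandermonde determinant. The state with index \<open>\<sigma> 0\<close>,
  absent from the edge of \<sigma>, carries exponent 0. Selecting edges by type alone keeps the
  response symmetric.\<close>

definition vandermonde_response ::
    "('v, 'h, 's, 't) hypernet \<Rightarrow> nat \<Rightarrow> 't \<Rightarrow> 'v \<Rightarrow> ('h \<Rightarrow> real list) \<Rightarrow> real" where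
  "vandermonde_response N k T v X =
     (\<Sum>h | h \<in> in_edges N v \<and> htype N h = T. \<Prod>i<k. (X h ! i) ^ Suc i)"

text \<open>A type-preserving bijection restricts to a bijection between the edges of type
  \<open>T\<close>, and this only reorders the sum.\<close>

lemma response_functions_vandermonde_response:
  "response_functions N (vandermonde_response N k T)"
  unfolding response_functions_def
proof (intro ballI allI impI, elim conjE)
  fix v1 v2 \<alpha> X
  assume "type_bij N v1 v2 \<alpha>"
  then have \<alpha>: "bij_betw \<alpha> (in_edges N v1) (in_edges N v2)"
    and type: "\<And>h. h \<in> in_edges N v1 \<Longrightarrow> htype N (\<alpha> h) = htype N h"
    unfolding type_bij_def by blast+
  let ?E = "\<lambda>v. {h. h \<in> in_edges N v \<and> htype N h = T}"
  have "\<alpha> ` ?E v1 = ?E v2"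
    using \<alpha> type unfolding bij_betw_def by force
  moreover have "inj_on \<alpha> (?E v1)"
    using \<alpha> unfolding bij_betw_def by (auto intro: inj_on_subset)
  ultimately have "bij_betw \<alpha> (?E v1) (?E v2)" by (simp add: bij_betw_def)
  then show "vandermonde_response N k T v2 X =
      vandermonde_response N k T v1 (\<lambda>h \<in> in_edges N v1. X (\<alpha> h))"
    unfolding vandermonde_response_def
    by (subst sum.reindex_bij_betw[symmetric]) (auto intro!: sum.cong)
qed

text \<open>The exponent vector of the summand of \<open>vandermonde_response\<close> that belongs
  to \<open>h\<close>.\<close>

lift_definition vandermonde_monomial :: "nat \<Rightarrow> 'h \<Rightarrow> ('h \<times> nat) \<Rightarrow>\<^sub>0 nat"
  is "\<lambda>k h (g, i). if g = h \<and> i < k then Suc i else 0"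
proof -
  fix k and h :: 'h
  have "{q. (case q of (g, i) \<Rightarrow> if g = h \<and> i < k then Suc i else 0) \<noteq> 0} \<subseteq> {h} \<times> {..<k}"
    by (auto split: if_splits)
  then show "finite {q. (case q of (g, i) \<Rightarrow> if g = h \<and> i < k then Suc i else 0) \<noteq> 0}"
    by (rule finite_subset) simp
qed

lemma keys_vandermonde_monomial: "Poly_Mapping.keys (vandermonde_monomial k h) = {h} \<times> {..<k}"
  by transfer (auto split: if_splits)

lemma inj_vandermonde_monomial:
  assumes "0 < k"
  shows "inj (vandermonde_monomial k)"
proof (rule injI)
  fix g h :: 'a
  assume "vandermonde_monomial k g = vandermonde_monomial k h"
  then have "{g} \<times> {..<k} = {h} \<times> {..<k}" by (metis keys_vandermonde_monomial)
  with assms show "g = h" by auto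
qed

lemma sum_lookup_vandermonde_monomial:
  "(\<Sum>q\<in>Poly_Mapping.keys (vandermonde_monomial k h). Poly_Mapping.lookup (vandermonde_monomial k h) q) =
     k * (k + 1) div 2"
proof -
  have "(\<Sum>q\<in>{h} \<times> {..<k}. Poly_Mapping.lookup (vandermonde_monomial k h) q) = (\<Sum>i<k. Suc i)"
    by (simp add: sum.cartesian_product' vandermonde_monomial.rep_eq)
  also have "\<dots> = \<Sum>{0..<card {0..k}}"
    by (simp add: lessThan_atLeast0[symmetric] sum.lessThan_Suc_shift
        del: sum.lessThan_Suc sum.op_ivl_Suc)
  finally show ?thesis
    by (simp only: keys_vandermonde_monomial sum_atLeast0LessThan_card_atLeastAtMost)
qed

text \<open>Distinct edges give distinct monomials, so every coefficient of \<open>p\<close> on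
  these monomials is 1 and all have the critical degree. The edge \<open>h0\<close> excludes
  \<open>p = 0\<close>, whose total degree would be 0.\<close>

lemma polynomial_response_vandermonde_response:
  fixes N :: "('v, 'h, 's, 't) hypernet"
  assumes k: "0 < k" and fin: "finite (in_edges N v)"
    and len: "\<And>h. h \<in> in_edges N v \<Longrightarrow> htype N h = T \<Longrightarrow> length (src N h) = k"
    and ne: "h0 \<in> in_edges N v" "htype N h0 = T"
  shows "polynomial_response N v (vandermonde_response N k T v) (k * (k + 1) div 2)"
proof -
  let ?E = "{h. h \<in> in_edges N v \<and> htype N h = T}"
  let ?m = "vandermonde_monomial k"
  define p :: "('h \<times> nat) real_mpoly" where "p = (\<Sum>h\<in>?E. Poly_Mapping.single (?m h) 1)"
  have finE: "finite ?E" using fin by simp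
  have inj: "?m g = ?m h \<longleftrightarrow> g = h" for g h :: 'h
    using inj_vandermonde_monomial[OF k] by (auto dest: injD)
  have lookup: "Poly_Mapping.lookup p m = (if m \<in> ?m ` ?E then 1 else 0)" for m
    using finE inj by (auto simp: p_def lookup_sum lookup_single when_def intro!: sum.neutral)
  have keys: "Poly_Mapping.keys p = ?m ` ?E"
    by (rule set_eqI) (simp add: in_keys_iff lookup)
  have "mpoly_vars p \<subseteq> (SIGMA h : in_edges N v. {..<length (src N h)})"
    using len by (auto simp: mpoly_vars_def keys keys_vandermonde_monomial)
  moreover have "mpoly_total_degree p = k * (k + 1) div 2"
  proof -
    have "(\<lambda>m. \<Sum>i\<in>Poly_Mapping.keys m. Poly_Mapping.lookup m i) ` Poly_Mapping.keys p =
        {k * (k + 1) div 2}"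
      unfolding keys image_image sum_lookup_vandermonde_monomial using ne by auto
    then show ?thesis by (simp add: mpoly_total_degree_def)
  qed
  moreover have "vandermonde_response N k T v X = mpoly_eval p (\<lambda>(h, i). X h ! i)" for X
  proof -
    have "mpoly_eval p (\<lambda>(h, i). X h ! i) =
        (\<Sum>h\<in>?E. \<Prod>(g, i)\<in>{h} \<times> {..<k}. (X g ! i) ^ Poly_Mapping.lookup (?m h) (g, i))"
      unfolding mpoly_eval_def keys
      by (subst sum.reindex)
         (auto simp: inj_on_def inj lookup keys_vandermonde_monomial split_def intro!: sum.cong prod.cong)
    also have "\<dots> = vandermonde_response N k T v X"
      unfolding vandermonde_response_def
      by (simp add: prod.cartesian_product[symmetric] vandermonde_monomial.rep_eq)
    finally show ?thesis by simp
  qed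
  ultimately show ?thesis unfolding polynomial_response_def by blast
qed

text \<open>By the rearrangement inequality the identity is the only permutation contributing the top
  power of \<open>t\<close>.\<close>

lemma even_odd_permutation_sums_differ:
  "\<exists>t :: real. (\<Sum>\<sigma> | \<sigma> permutes {0..k} \<and> parity_index \<sigma> = 0. t ^ (\<Sum>i\<le>k. \<sigma> i * i)) \<noteq>
     (\<Sum>\<sigma> | \<sigma> permutes {0..k} \<and> parity_index \<sigma> = 1. t ^ (\<Sum>i\<le>k. \<sigma> i * i))"
proof -
  let ?P = "\<lambda>j. {\<sigma>. \<sigma> permutes {0..k} \<and> parity_index \<sigma> = j}"
  let ?e = "\<lambda>\<sigma>. \<Sum>i\<le>k. \<sigma> i * i"
  have fin: "finite (?P j)" for j
    by (rule finite_subset[OF _ finite_permutations[of "{0..k}"]]) auto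
  have unique: "\<sigma> = id" if \<sigma>: "\<sigma> permutes {0..k}" and e: "?e \<sigma> = ?e id" for \<sigma>
  proof -
    \<comment> \<open>This is the equality case of the rearrangement inequality: a permutation
      preserves the sum of squares, so equal cross terms force the sum of
      \<open>(\<sigma> i - i)^2\<close> to vanish. Integers avoid truncated subtraction.\<close>
    have sq: "(\<Sum>i\<le>k. int (\<sigma> i) ^ 2) = (\<Sum>i\<le>k. int i ^ 2)"
      using sum.permute[OF \<sigma>, of "\<lambda>i. int i ^ 2"] by (simp add: atMost_atLeast0 o_def)
    have cross: "(\<Sum>i\<le>k. int (\<sigma> i) * int i) = (\<Sum>i\<le>k. int i ^ 2)"
      using arg_cong[OF e, of int] by (simp add: power2_eq_square)
    have "(\<Sum>i\<le>k. (int (\<sigma> i) - int i) ^ 2) =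
        (\<Sum>i\<le>k. int (\<sigma> i) ^ 2) + (\<Sum>i\<le>k. int i ^ 2) - 2 * (\<Sum>i\<le>k. int (\<sigma> i) * int i)"
      by (simp add: power2_diff sum.distrib sum_subtractf sum_distrib_left mult.assoc)
    also have "\<dots> = 0" using sq cross by simp
    finally have "\<forall>i\<in>{..k}. (int (\<sigma> i) - int i) ^ 2 = 0"
      by (subst (asm) sum_nonneg_eq_0_iff) auto
    then have "\<sigma> i = i" if "i \<le> k" for i using that by auto
    moreover have "\<sigma> i = i" if "\<not> i \<le> k" for i
      using \<sigma> that by (auto simp: permutes_def)
    ultimately show ?thesis by (auto simp: fun_eq_iff)
  qed
  \<comment> \<open>Both sums become polynomials in \<open>t\<close>. They differ in the coefficient
    at \<open>?e id\<close>, as \<open>id\<close> is even, and distinct real polynomials differ at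
    some point.\<close>
  define Q :: "nat \<Rightarrow> real poly" where "Q j = (\<Sum>\<sigma>\<in>?P j. monom 1 (?e \<sigma>))" for j
  have coeff: "coeff (Q j) (?e id) = (if j = 0 then 1 else 0)" for j
  proof -
    have "coeff (Q j) (?e id) = (\<Sum>\<sigma>\<in>?P j. if \<sigma> = id then 1 else 0)"
      unfolding Q_def coeff_sum coeff_monom
      by (intro sum.cong) (use unique in auto)
    also have "\<dots> = (if id \<in> ?P j then 1 else 0)" by (simp add: fin)
    also have "id \<in> ?P j \<longleftrightarrow> j = 0" by (auto simp: parity_index_def permutes_id)
    finally show ?thesis by simp
  qed
  have "Q 0 \<noteq> Q 1" using coeff[of 0] coeff[of 1] by auto
  then obtain t where "poly (Q 0) t \<noteq> poly (Q 1) t"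
    using poly_eq_poly_eq_iff by blast
  then show ?thesis by (auto simp: Q_def poly_sum poly_monom)
qed

text \<open>At core states \<open>t^j\<close> each product collapses to one power of
  \<open>t\<close>, and the y-components become the even and odd sums already known to differ for
  some \<open>t\<close>.\<close>

lemma vandermonde_response_not_invariant:
  assumes \<nu>: "inj_on \<nu> {0..k}" "\<nu> ` {0..k} \<subseteq> verts N"
  shows "\<not> invariant_under
      (vector_field (augmented N k \<nu>) (vandermonde_response (augmented N k \<nu>) k Perm_type))
      (w_synchrony_space (augmented N k \<nu>))"
proof
  let ?A = "augmented N k \<nu>"
  let ?F = "vandermonde_response ?A k Perm_type"
  let ?P = "\<lambda>j. {\<sigma>. \<sigma> permutes {0..k} \<and> parity_index \<sigma> = j}"
  assume inv: "invariant_under (vector_field ?A ?F) (w_synchrony_space ?A)"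
  obtain t :: real where
    t: "(\<Sum>\<sigma>\<in>?P 0. t ^ (\<Sum>i\<le>k. \<sigma> i * i)) \<noteq> (\<Sum>\<sigma>\<in>?P 1. t ^ (\<Sum>i\<le>k. \<sigma> i * i))"
    using even_odd_permutation_sums_differ by blast
  \<comment> \<open>\<open>inv_into\<close> recovers the index of a core node; both y-states are 0,
    which places \<open>x\<close> in the synchrony space.\<close>
  define x where "x = (\<lambda>a \<in> verts ?A. case a of Core v \<Rightarrow> t ^ inv_into {0..k} \<nu> v | W _ \<Rightarrow> 0)"
  have x_core: "x (Core (\<nu> j)) = t ^ j" if "j \<le> k" for j
  proof -
    have "\<nu> j \<in> verts N" using \<nu>(2) that by auto
    then show ?thesis using that \<nu>(1) by (simp add: x_def augmented_def)
  qed
  have "x \<in> w_synchrony_space ?A"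
    by (simp add: w_synchrony_space_def state_space_def x_def augmented_def)
  with inv have eq: "vector_field ?A ?F x (W 0) = vector_field ?A ?F x (W 1)"
    unfolding invariant_under_def w_synchrony_space_def by blast
  have "vector_field ?A ?F x (W j) = (\<Sum>\<sigma>\<in>?P j. t ^ (\<Sum>i\<le>k. \<sigma> i * i))" if j: "j \<in> {0, 1}" for j
  proof -
    have edges: "{h. h \<in> in_edges ?A (W j) \<and> htype ?A h = Perm_type} = Perm_edge ` ?P j"
      unfolding in_edges_augmented_W[OF j] by (auto simp: augmented_def)
    have "vector_field ?A ?F x (W j) =
        (\<Sum>\<sigma>\<in>?P j. \<Prod>i<k. x (Core (\<nu> (\<sigma> (Suc i)))) ^ Suc i)"
      unfolding vector_field_augmented_W[OF j] vandermonde_response_def edges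
      by (subst sum.reindex) (auto simp: inj_on_def simp del: upt_Suc power_Suc intro!: sum.cong prod.cong)
    also have "\<dots> = (\<Sum>\<sigma>\<in>?P j. t ^ (\<Sum>i\<le>k. \<sigma> i * i))"
    proof (rule sum.cong[OF refl])
      fix \<sigma> assume "\<sigma> \<in> ?P j"
      then have "\<sigma> (Suc i) \<le> k" if "i < k" for i
        using permutes_in_image[of \<sigma> "{0..k}" "Suc i"] that by auto
      then have "(\<Prod>i<k. x (Core (\<nu> (\<sigma> (Suc i)))) ^ Suc i) = (\<Prod>i<k. t ^ (\<sigma> (Suc i) * Suc i))"
        by (intro prod.cong) (auto simp: x_core power_mult simp del: power_Suc mult_Suc_right)
      also have "\<dots> = t ^ (\<Sum>i<k. \<sigma> (Suc i) * Suc i)"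
        by (simp add: power_sum del: power_Suc mult_Suc_right)
      \<comment> \<open>The added index 0 contributes \<open>\<sigma> 0 * 0 = 0\<close>.\<close>
      also have "(\<Sum>i<k. \<sigma> (Suc i) * Suc i) = (\<Sum>i\<le>k. \<sigma> i * i)"
        by (simp add: sum.atMost_shift del: mult_Suc_right)
      finally show "(\<Prod>i<k. x (Core (\<nu> (\<sigma> (Suc i)))) ^ Suc i) = t ^ (\<Sum>i\<le>k. \<sigma> i * i)" .
    qed
    finally show ?thesis .
  qed
  with eq t show False by simp
qed

theorem theorem5p4:
  fixes N :: "('v, 'h, 's, 't) hypernet"
    and k :: nat
    and \<nu> :: "nat \<Rightarrow> 'v"
  defines "A \<equiv> augmented N k \<nu>"
  assumes "2 \<le> k"
    and "hypernetwork N"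
    and "bij_betw \<nu> {0..k} (verts N)"
    and "\<forall>u \<in> verts N. \<forall>v \<in> verts N. vtype N u = vtype N v"
  shows "(\<forall>F d. response_functions A F \<and> polynomial_response A (W 0) (F (W 0)) d \<and>
              d < k * (k + 1) div 2 \<longrightarrow>
              invariant_under (vector_field A F) (w_synchrony_space A)) \<and>
         \<not> (\<forall>F. response_functions A F \<and>
              polynomial_response A (W 0) (F (W 0)) (k * (k + 1) div 2) \<longrightarrow>
              invariant_under (vector_field A F) (w_synchrony_space A)) \<and>
         \<not> robustly_invariant A (w_synchrony_space A)"
proof -
  let ?F = "vandermonde_response A k Perm_type"
  have "invariant_under (vector_field A F) (w_synchrony_space A)"
    if "response_functions A F" "polynomial_response A (W 0) (F (W 0)) d" "d < k * (k + 1) div 2"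
    for F d
  proof -
    have "vector_field A F x (W 0) = vector_field A F x (W 1)" if "x (W 0) = x (W 1)" for x
      unfolding A_def
      by (rule vector_field_W_eq) (use assms(2) \<open>response_functions A F\<close> that
        \<open>polynomial_response A (W 0) (F (W 0)) d\<close> \<open>d < _\<close> in \<open>simp_all add: A_def\<close>)
    moreover have "vector_field A F x \<in> state_space A" for x
      by (simp add: vector_field_def state_space_def)
    ultimately show ?thesis
      unfolding invariant_under_def w_synchrony_space_def by blast
  qed
  moreover have F: "response_functions A ?F"
    by (rule response_functions_vandermonde_response)
  moreover have "polynomial_response A (W 0) (?F (W 0)) (k * (k + 1) div 2)"
  proof (rule polynomial_response_vandermonde_response)
    have edges: "in_edges A (W 0) =
        insert (Loop 0) (Perm_edge ` {\<sigma>. \<sigma> permutes {0..k} \<and> parity_index \<sigma> = 0})"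
      unfolding A_def by (rule in_edges_augmented_W) simp
    show "finite (in_edges A (W 0))"
      by (simp add: edges finite_permutations)
    show "Perm_edge id \<in> in_edges A (W 0)"
      by (simp add: edges permutes_id parity_index_def)
    show "htype A (Perm_edge id) = Perm_type" by (simp add: A_def augmented_def)
    show "length (src A h) = k" if "h \<in> in_edges A (W 0)" "htype A h = Perm_type" for h
      using that by (auto simp: edges) (auto simp: A_def augmented_def)
  qed (use assms(2) in simp)
  moreover have not_inv: "\<not> invariant_under (vector_field A ?F) (w_synchrony_space A)"
    unfolding A_def using assms(4)
    by (intro vandermonde_response_not_invariant) (auto simp: bij_betw_def)
  \<comment> \<open>The same field, being admissible, also refutes robustness.\<close>
  moreover have "admissible A (vector_field A ?F)"
    using F unfolding admissible_def by blast
  ultimately show ?thesis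
    unfolding robustly_invariant_def by blast
qed

end
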